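(* Let $A\subseteq\mathbb{R}$ be an open invex subset with respect to $\eta:A\times A\to\mathbb{R}$. Let $q>1$ and let $p$ satisfy $p^{-1}+q^{-1}=1$. Suppose that $f:A\to\mathbb{R}$ is a three times differentiable function and that $|f'''|^{q}$ is preinvex on $A$ with respect to $\eta$. Then for every $a,b\in A$ with $\eta(b,a)\neq 0$, $$\left|\int_{b}^{b+\eta(a,b)}f(x)\,dx-\eta(a,b)\,\frac{f(b)+f(b+\eta(a,b))}{2}-\frac{(\eta(a,b))^{2}}{12}\left[f'(b)-f'(b+\eta(a,b))\right]\right|\le\frac{(\eta(a,b))^{4}}{96}\left(\sqrt{\pi}\right)^{\frac1p}\left(\frac{\Gamma(1+p)}{\Gamma\left(\frac32+p\right)}\right)^{\frac1p}\left(\frac{1}{q+1}\right)^{\frac1q}\left[|f'''(a)|^{q}+|f'''(b)|^{q}\right]^{\frac1q},$$ where $\Gamma$ is the Euler Gamma function.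
   Context: A set $A\subseteq\mathbb{R}$ is invex with respect to $\eta:A\times A\to\mathbb{R}$ if $u+t\,\eta(v,u)\in A$ for all $u,v\in A$ and all $t\in[0,1]$. A function $g:A\to\mathbb{R}$ on an invex set $A$ is preinvex with respect to $\eta$ if $g(u+t\,\eta(v,u))\le(1-t)g(u)+t\,g(v)$ for all $u,v\in A$ and all $t\in[0,1]$. Integrals $\int_c^d$ are oriented (the upper limit may be less than the lower limit). *)

theory Defs
  imports "HOL-Analysis.Analysis"
begin

text \<open>The map \<open>\<eta> : A \<times> A \<rightarrow> \<real>\<close> is rendered as a total binary function; only its values at
  points of \<open>A\<close> are ever used. As with the library's convexity of functions, preinvexity on \<open>A\<close>
  includes invexity of \<open>A\<close>.\<close>

definition invex :: "(real \<Rightarrow> real \<Rightarrow> real) \<Rightarrow> real set \<Rightarrow> bool"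
  where "invex \<eta> A \<longleftrightarrow> (\<forall>u\<in>A. \<forall>v\<in>A. \<forall>t\<in>{0..1}. u + t * \<eta> v u \<in> A)"

definition preinvex_on :: "(real \<Rightarrow> real \<Rightarrow> real) \<Rightarrow> real set \<Rightarrow> (real \<Rightarrow> real) \<Rightarrow> bool"
  where "preinvex_on \<eta> A g \<longleftrightarrow> invex \<eta> A \<and>
    (\<forall>u\<in>A. \<forall>v\<in>A. \<forall>t\<in>{0..1}. g (u + t * \<eta> v u) \<le> (1 - t) * g u + t * g v)"

end

theory Submission
  imports Defs
begin

text \<open>
  Put \<open>c = \<eta> a b\<close> and pull everything back to \<open>[0,1]\<close> along \<open>t \<mapsto> b + t c\<close>, a path that invexity
  keeps inside \<open>A\<close>. The quantity to be bounded is the error of the trapezoidal rule with the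
  Euler--Maclaurin end correction. Integrating by parts three times against the polynomial
  \<open>K(t) = t (1 - t) (2 t - 1)\<close>, for which \<open>K''' = -12\<close>, gives (\<open>corrected_trapezoid_identity\<close>)
    error \<open>= c\<^sup>4 / 12 \<cdot> \<integral>\<^sub>0\<^sup>1 K(t) f'''(b + t c) dt\<close>.

  Hoelder's inequality is then applied to the factorisation of the integrand into \<open>t (1 - t)\<close>, whose
  \<open>p\<close>-th power integrates to a Beta value, and \<open>(2 t - 1) f'''(b + t c)\<close>. Preinvexity gives
  \<open>|f'''(b + t c)|\<^sup>q \<le> (1 - t) |f'''(b)|\<^sup>q + t |f'''(a)|\<^sup>q\<close>, and the weight \<open>|2 t - 1|\<^sup>q\<close> is symmetric
  about \<open>1/2\<close>, so the \<open>q\<close>-th power integrates to at most half of \<open>|f'''(a)|\<^sup>q + |f'''(b)|\<^sup>q\<close> divided by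
  \<open>q + 1\<close>. The duplication formula turns \<open>B(1 + p, 1 + p)\<close> into the quotient of Gamma values in the
  bound, and the powers of two collect to \<open>2\<^sup>2 \<cdot> 2 powr (1/p + 1/q) = 8\<close>, hence \<open>96 = 12 \<cdot> 8\<close>.

  The function \<open>f'''\<close> is merely a derivative and may be discontinuous, so all integrals of it are
  Henstock--Kurzweil integrals, for which the fundamental theorem of calculus holds without any
  integrability hypothesis. Hoelder's inequality is proved in a form (\<open>integral_bound_Holder\<close>) that
  asks only for a pointwise majorant \<open>u v\<close> of the integrand; here \<open>u\<close> and \<open>v\<close> are continuous, and
  neither measurability nor absolute integrability of \<open>f'''\<close> ever has to be discussed.
\<close>

section \<open>Hoelder's inequality for a dominated integrand\<close>

text \<open>
  Young's inequality, applied to \<open>u / \<alpha>\<close> and \<open>v / \<beta>\<close>, replaces the product by a combination of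
  \<open>u powr p\<close> and \<open>v powr q\<close>, which is integrable by hypothesis; the choice
  \<open>\<alpha> powr p = U\<close>, \<open>\<beta> powr q = V\<close> is the optimal one. Since \<open>U\<close> or \<open>V\<close> may vanish, both are first
  enlarged by some \<open>e > 0\<close>, and \<open>e\<close> tends to \<open>0\<close> at the end.
\<close>
lemma integral_bound_Holder:
  fixes h u v :: "real \<Rightarrow> real"
  assumes p: "p > 1" and q: "q > 1" and pq: "1 / p + 1 / q = 1"
    and h: "(h has_integral I) S"
    and U: "((\<lambda>x. u x powr p) has_integral U) S"
    and V: "((\<lambda>x. v x powr q) has_integral V) S"
    and nonneg: "\<And>x. x \<in> S \<Longrightarrow> 0 \<le> u x" "\<And>x. x \<in> S \<Longrightarrow> 0 \<le> v x"
    and le: "\<And>x. x \<in> S \<Longrightarrow> \<bar>h x\<bar> \<le> u x * v x"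
  shows "\<bar>I\<bar> \<le> U powr (1 / p) * V powr (1 / q)"
proof -
  have U0: "U \<ge> 0" and V0: "V \<ge> 0"
    by (rule has_integral_nonneg[OF U] has_integral_nonneg[OF V], simp)+
  have ineq: "\<bar>I\<bar> \<le> (U + e) powr (1 / p) * (V + e) powr (1 / q)" if e: "e > 0" for e
  proof -
    define \<alpha> where "\<alpha> = (U + e) powr (1 / p)"
    define \<beta> where "\<beta> = (V + e) powr (1 / q)"
    have pos: "\<alpha> > 0" "\<beta> > 0"
      using U0 V0 e by (auto simp: \<alpha>_def \<beta>_def)
    have \<alpha>p: "\<alpha> powr p = U + e" and \<beta>q: "\<beta> powr q = V + e"
      using U0 V0 e p q by (auto simp: \<alpha>_def \<beta>_def powr_powr)
    define G where "G = (\<lambda>x. \<alpha> * \<beta> * (u x powr p / (p * (U + e)) + v x powr q / (q * (V + e))))"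
    have hG: "\<bar>h x\<bar> \<le> G x" if x: "x \<in> S" for x
    proof -
      have "(u x / \<alpha>) * (v x / \<beta>) \<le> (u x / \<alpha>) powr p / p + (v x / \<beta>) powr q / q"
        using p q pq pos nonneg[OF x] by (intro Youngs_inequality) auto
      also have "\<dots> = u x powr p / (p * (U + e)) + v x powr q / (q * (V + e))"
        using pos nonneg[OF x] by (simp add: powr_divide \<alpha>p \<beta>q mult.commute)
      finally have "u x * v x \<le> G x"
        using pos by (simp add: G_def field_simps)
      with le[OF x] show ?thesis by linarith
    qed
    have G: "(G has_integral \<alpha> * \<beta> * (U / (p * (U + e)) + V / (q * (V + e)))) S"
      unfolding G_def by (intro has_integral_mult_right has_integral_add has_integral_divide U V)
    have "\<bar>I\<bar> \<le> \<alpha> * \<beta> * (U / (p * (U + e)) + V / (q * (V + e)))"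
      using integral_norm_bound_integral[of h S G] h G hG
      by (simp add: integral_unique has_integral_integrable)
    also have "\<dots> \<le> \<alpha> * \<beta> * (1 / p + 1 / q)"
      using U0 V0 e p q pos
      by (intro mult_left_mono add_mono)
         (auto simp: divide_simps mult_left_mono simp flip: distrib_left)
    finally show ?thesis by (simp add: pq \<alpha>_def \<beta>_def)
  qed
  have "((\<lambda>e. (U + e) powr (1 / p) * (V + e) powr (1 / q)) \<longlongrightarrow>
          (U + 0) powr (1 / p) * (V + 0) powr (1 / q)) (at_right 0)"
    using U0 V0 p q
    by (intro tendsto_mult tendsto_powr' tendsto_intros)
       (auto simp: eventually_at_right_less intro!: eventually_at_rightI[of 0 1])
  then show ?thesis
    by (intro tendsto_lowerbound[where F = "at_right (0::real)"])
       (auto intro!: eventually_at_rightI[of 0 1] ineq)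
qed

section \<open>The two weight integrals\<close>

text \<open>
  This is the duplication formula for \<open>\<Gamma>(2 z)\<close> at \<open>z = 1 + p\<close>, inserted into
  \<open>B(z, z) = \<Gamma>(z)\<^sup>2 / \<Gamma>(2 z)\<close>.
\<close>
lemma Beta_diagonal:
  fixes p :: real
  assumes "p > -1"
  shows "Beta (1 + p) (1 + p) = sqrt pi * (Gamma (1 + p) / Gamma (3 / 2 + p)) / 2 powr (2 * p + 1)"
proof -
  define z where "z = complex_of_real (1 + p)"
  have "z \<notin> \<int>\<^sub>\<le>\<^sub>0" "z + 1 / 2 \<notin> \<int>\<^sub>\<le>\<^sub>0"
    using assms by (auto simp: z_def elim!: nonpos_Ints_cases dest!: arg_cong[of _ _ Re])
  then have "Gamma z * Gamma (z + 1 / 2) =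
      exp ((1 - 2 * z) * of_real (ln 2)) * of_real (sqrt pi) * Gamma (2 * z)"
    by (rule Gamma_legendre_duplication)
  also have "z + 1 / 2 = complex_of_real (3 / 2 + p)" by (simp add: z_def)
  also have "2 * z = complex_of_real (2 * (1 + p))" by (simp add: z_def)
  also have "(1 - complex_of_real (2 * (1 + p))) * of_real (ln 2) = of_real (- (2 * p + 1) * ln 2)"
    by (simp add: algebra_simps)
  finally have "complex_of_real (Gamma (1 + p) * Gamma (3 / 2 + p)) =
      complex_of_real (exp (- (2 * p + 1) * ln 2) * sqrt pi * Gamma (2 * (1 + p)))"
    unfolding z_def Gamma_complex_of_real exp_of_real by simp
  then have dup: "Gamma (1 + p) * Gamma (3 / 2 + p) =
      exp (- (2 * p + 1) * ln 2) * sqrt pi * Gamma (2 * (1 + p))"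
    by (rule of_real_eq_iff[THEN iffD1])
  have pos: "Gamma (1 + p) > 0" "Gamma (3 / 2 + p) > 0" "Gamma (2 * (1 + p)) > 0"
    using assms by (auto intro!: Gamma_real_pos)
  have "exp (- (2 * p + 1) * ln 2) = inverse (2 powr (2 * p + 1))"
    by (simp add: powr_def exp_minus[symmetric] algebra_simps)
  with dup pos show ?thesis
    by (simp add: Beta_def field_simps)
qed

lemma has_real_derivative_abs_powr:
  fixes x q :: real
  assumes "x \<noteq> 0"
  shows "((\<lambda>x. \<bar>x\<bar> powr q) has_real_derivative q * \<bar>x\<bar> powr q / x) (at x)"
proof -
  \<comment> \<open>Writing the power through \<open>y\<^sup>2\<close> removes the absolute value and with it the case distinction
      on the sign.\<close>
  have sq: "\<bar>y\<bar> powr q = (y\<^sup>2) powr (q / 2)" for y :: real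
  proof -
    have "y\<^sup>2 = \<bar>y\<bar> powr 2" by simp
    then show ?thesis by (simp only: powr_powr) simp
  qed
  have "((\<lambda>x. (x\<^sup>2) powr (q / 2)) has_real_derivative q / 2 * (x\<^sup>2) powr (q / 2 - 1) * (2 * x)) (at x)"
    using assms by (auto intro!: derivative_eq_intros)
  also have "q / 2 * (x\<^sup>2) powr (q / 2 - 1) * (2 * x) = q * \<bar>x\<bar> powr q / x"
    using assms by (simp add: powr_diff sq power2_eq_square)
  finally show ?thesis by (simp add: sq)
qed

text \<open>
  With \<open>s = 2 t - 1\<close> the affine factor is \<open>(A + B) / 2 + s (A - B) / 2\<close>. The part odd in \<open>s\<close> cancels
  against the even weight, which leaves only the mean of \<open>A\<close> and \<open>B\<close>.
\<close>
lemma has_integral_abs_powr_affine: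
  fixes q A B :: real
  assumes q: "q > 0"
  shows "((\<lambda>t. \<bar>2 * t - 1\<bar> powr q * ((1 - t) * B + t * A)) has_integral (A + B) / (2 * (q + 1))) {0..1}"
proof -
  \<comment> \<open>In terms of \<open>s\<close>, the functions \<open>|s|\<^sup>q\<close> and \<open>s |s|\<^sup>q\<close> have the primitives \<open>s |s|\<^sup>q / (q + 1)\<close> and
      \<open>s\<^sup>2 |s|\<^sup>q / (q + 2)\<close>. One factor \<open>1/2\<close> in \<open>\<alpha>\<close> and \<open>\<beta>\<close> comes from the affine factor, the other
      from \<open>ds = 2 dt\<close>.\<close>
  define \<alpha> where "\<alpha> = (A + B) / 4"
  define \<beta> where "\<beta> = (A - B) / 4"
  define F where "F = (\<lambda>t. (\<alpha> * ((2 * t - 1) / (q + 1)) + \<beta> * ((2 * t - 1)\<^sup>2 / (q + 2)))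
                         * \<bar>2 * t - 1\<bar> powr q)"
  have "((\<lambda>t. \<bar>2 * t - 1\<bar> powr q * ((1 - t) * B + t * A)) has_integral F 1 - F 0) {0..1}"
  proof (rule fundamental_theorem_of_calculus_interior_strong[of "{1/2}"])
    have "continuous_on {0..1} (\<lambda>t::real. \<bar>2 * t - 1\<bar> powr q)"
      using q by (intro continuous_on_powr') (auto intro!: continuous_intros)
    then show "continuous_on {0..1} F"
      unfolding F_def using q
      by (intro continuous_on_mult) (auto intro!: continuous_intros)
  next
    fix t :: real assume "t \<in> {0<..<1} - {1 / 2}"
    then have nz: "2 * t - 1 \<noteq> 0" by auto
    define P where "P = \<bar>2 * t - 1\<bar> powr q"
    have D1: "((\<lambda>t. 2 * t - 1) has_real_derivative 2) (at t)"
      and D2: "((\<lambda>t. (2 * t - 1)\<^sup>2) has_real_derivative 4 * (2 * t - 1)) (at t)"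
      by (auto intro!: derivative_eq_intros)
    have D: "((\<lambda>t. \<bar>2 * t - 1\<bar> powr q) has_real_derivative 2 * q * P / (2 * t - 1)) (at t)"
      using DERIV_chain2[where g = "\<lambda>t. 2 * t - 1", OF has_real_derivative_abs_powr[OF nz] D1]
      by (simp add: P_def mult_ac)
    have alg: "(\<alpha> * (2 / (q + 1)) + \<beta> * (4 * s / (q + 2))) * P
          + 2 * q * P / s * (\<alpha> * (s / (q + 1)) + \<beta> * (s\<^sup>2 / (q + 2))) = P * (2 * \<alpha> + 2 * \<beta> * s)"
      if "s \<noteq> 0" for s :: real
    proof -
      have "2 * q * P / s * (\<alpha> * (s / (q + 1)) + \<beta> * (s\<^sup>2 / (q + 2)))
          = 2 * q * P * (\<alpha> / (q + 1) + \<beta> * s / (q + 2))"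
        using that by (simp add: power2_eq_square ring_distribs)
      then have "(\<alpha> * (2 / (q + 1)) + \<beta> * (4 * s / (q + 2))) * P
          + 2 * q * P / s * (\<alpha> * (s / (q + 1)) + \<beta> * (s\<^sup>2 / (q + 2)))
          = 2 * P * \<alpha> * ((1 + q) / (q + 1)) + 2 * P * \<beta> * s * ((2 + q) / (q + 2))"
        by (simp add: add_divide_distrib ring_distribs mult_ac)
      then show ?thesis using q by (simp add: ring_distribs add.commute)
    qed
    have "(F has_real_derivative
        (\<alpha> * (2 / (q + 1)) + \<beta> * (4 * (2 * t - 1) / (q + 2))) * P
        + 2 * q * P / (2 * t - 1) *
          (\<alpha> * ((2 * t - 1) / (q + 1)) + \<beta> * ((2 * t - 1)\<^sup>2 / (q + 2)))) (at t)"
      unfolding F_def P_def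
      by (intro DERIV_mult DERIV_add DERIV_cmult DERIV_cdivide D1 D2 D[unfolded P_def])
    then have "(F has_real_derivative P * (2 * \<alpha> + 2 * \<beta> * (2 * t - 1))) (at t)"
      by (simp only: alg[OF nz])
    also have "2 * \<alpha> + 2 * \<beta> * (2 * t - 1) = (1 - t) * B + t * A"
      by (simp add: \<alpha>_def \<beta>_def field_simps)
    finally show "(F has_vector_derivative \<bar>2 * t - 1\<bar> powr q * ((1 - t) * B + t * A)) (at t)"
      by (simp add: has_real_derivative_iff_has_vector_derivative P_def)
  qed auto
  also have "F 1 - F 0 = (A + B) / (2 * (q + 1))"
  proof -
    have "F 1 - F 0 = 2 * (\<alpha> / (q + 1))" by (simp add: F_def)
    then show ?thesis using q by (simp add: \<alpha>_def field_simps)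
  qed
  finally show ?thesis .
qed

section \<open>The error of the end-corrected trapezoidal rule\<close>

text \<open>
  For \<open>K = t (1 - t) (2 t - 1)\<close> the function \<open>K g'' - K' g' + K'' g\<close> has derivative
  \<open>K g''' + K''' g = K g''' - 12 g\<close>. At both ends \<open>K = 0\<close> and \<open>K' = -1\<close>, while \<open>K''\<close> is \<open>6\<close> at \<open>0\<close> and
  \<open>-6\<close> at \<open>1\<close>, so its boundary values are those of the quadrature rule.
\<close>
lemma corrected_trapezoid_identity:
  fixes g g1 g2 g3 :: "real \<Rightarrow> real"
  assumes g: "\<And>t. t \<in> {0..1} \<Longrightarrow> (g has_real_derivative g1 t) (at t)"
    and g1: "\<And>t. t \<in> {0..1} \<Longrightarrow> (g1 has_real_derivative g2 t) (at t)"
    and g2: "\<And>t. t \<in> {0..1} \<Longrightarrow> (g2 has_real_derivative g3 t) (at t)"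
  shows "((\<lambda>t. t * (1 - t) * (2 * t - 1) * g3 t) has_integral
           12 * (integral {0..1} g - (g 0 + g 1) / 2 - (g1 0 - g1 1) / 12)) {0..1}"
proof -
  have "continuous_on {0..1} g"
    using g by (meson DERIV_isCont continuous_at_imp_continuous_on)
  then have int: "(g has_integral integral {0..1} g) {0..1}"
    by (intro integrable_integral integrable_continuous_real)
  define F where "F = (\<lambda>t. t * (1 - t) * (2 * t - 1) * g2 t - (6 * t - 6 * t\<^sup>2 - 1) * g1 t
                          + (6 - 12 * t) * g t)"
  have "((\<lambda>t. t * (1 - t) * (2 * t - 1) * g3 t - 12 * g t) has_integral F 1 - F 0) {0..1}"
  proof (rule fundamental_theorem_of_calculus)
    fix t :: real assume t: "t \<in> {0..1}"
    have "(F has_real_derivative t * (1 - t) * (2 * t - 1) * g3 t - 12 * g t) (at t)"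
      unfolding F_def
      by (rule derivative_eq_intros g[OF t] g1[OF t] g2[OF t] refl)+
         (simp add: algebra_simps power2_eq_square)
    then show "(F has_vector_derivative t * (1 - t) * (2 * t - 1) * g3 t - 12 * g t)
                 (at t within {0..1})"
      by (simp add: has_real_derivative_iff_has_vector_derivative has_vector_derivative_at_within)
  qed simp
  from has_integral_add[OF this has_integral_mult_right[OF int, of 12]]
  have "((\<lambda>t. t * (1 - t) * (2 * t - 1) * g3 t) has_integral
           F 1 - F 0 + 12 * integral {0..1} g) {0..1}" by simp
  also have "F 1 - F 0 + 12 * integral {0..1} g =
      12 * (integral {0..1} g - (g 0 + g 1) / 2 - (g1 0 - g1 1) / 12)"
    by (simp add: F_def diff_divide_distrib add_divide_distrib algebra_simps)
  finally show ?thesis .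
qed

section \<open>The bound for preinvex third derivatives\<close>

theorem theorem3:
  fixes A :: "real set" and \<eta> :: "real \<Rightarrow> real \<Rightarrow> real" and f :: "real \<Rightarrow> real"
    and p q a b :: real
  assumes "open A" and "invex \<eta> A"
    and "q > 1" and "inverse p + inverse q = 1"
    and "f differentiable_on A"
    and "deriv f differentiable_on A"
    and "deriv (deriv f) differentiable_on A"
    and "preinvex_on \<eta> A (\<lambda>x. \<bar>deriv (deriv (deriv f)) x\<bar> powr q)"
    and "a \<in> A" and "b \<in> A" and "\<eta> b a \<noteq> 0"
  shows "\<bar>(LBINT x=ereal b..ereal (b + \<eta> a b). f x)
          - \<eta> a b * ((f b + f (b + \<eta> a b)) / 2)
          - (\<eta> a b)^2 / 12 * (deriv f b - deriv f (b + \<eta> a b))\<bar>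
        \<le> (\<eta> a b)^4 / 96 * sqrt pi powr (1 / p)
          * (Gamma (1 + p) / Gamma (3 / 2 + p)) powr (1 / p)
          * (1 / (q + 1)) powr (1 / q)
          * (\<bar>deriv (deriv (deriv f)) a\<bar> powr q + \<bar>deriv (deriv (deriv f)) b\<bar> powr q) powr (1 / q)"
proof -
  define c where "c = \<eta> a b"
  define f3 where "f3 = deriv (deriv (deriv f))"
  define M where "M = \<bar>f3 a\<bar> powr q"
  define N where "N = \<bar>f3 b\<bar> powr q"
  define W where "W = (\<lambda>t. (1 - t) * N + t * M)"
  have q: "q > 1" by fact
  have pq: "1 / p + 1 / q = 1" using assms(4) by (simp add: inverse_eq_divide)
  have p: "p > 1"
  proof -
    have "1 / q < 1" "1 / q > 0" using q by auto
    with pq have "0 < 1 / p" "1 / p < 1" by linarith+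
    then show ?thesis by (simp add: divide_simps split: if_splits)
  qed
  have MN: "M \<ge> 0" "N \<ge> 0" by (simp_all add: M_def N_def)

  have seg: "b + t * c \<in> A" if "t \<in> {0..1}" for t
    using assms(2,9,10) that by (simp add: invex_def c_def)
  have f3_le: "\<bar>f3 (b + t * c)\<bar> powr q \<le> W t" if "t \<in> {0..1}" for t
    using assms(8,9,10) that by (simp add: preinvex_on_def c_def f3_def W_def M_def N_def)

  have deriv_at: "(g has_real_derivative deriv g x) (at x)"
    if "g differentiable_on A" "x \<in> A" for g :: "real \<Rightarrow> real" and x
    using that assms(1) by (metis at_within_open differentiable_on_def DERIV_deriv_iff_real_differentiable)
  have line: "((\<lambda>t. k * g (b + t * c)) has_real_derivative k * c * deriv g (b + t * c)) (at t)"
    if "g differentiable_on A" "t \<in> {0..1}" for g :: "real \<Rightarrow> real" and t k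
  proof -
    have "((\<lambda>t. g (b + t * c)) has_real_derivative deriv g (b + t * c) * c) (at t)"
      using deriv_at[OF that(1) seg[OF that(2)]]
      by (rule DERIV_chain2) (auto intro!: derivative_eq_intros)
    from DERIV_cmult[OF this, of k] show ?thesis by (simp add: mult_ac)
  qed

  define J where "J = integral {0..1} (\<lambda>t. f (b + t * c))
       - (f b + f (b + c)) / 2 - (c * deriv f b - c * deriv f (b + c)) / 12"
  have "((\<lambda>t. t * (1 - t) * (2 * t - 1) * (c * c * c * f3 (b + t * c))) has_integral
      12 * (integral {0..1} (\<lambda>t. f (b + t * c)) - (f (b + 0 * c) + f (b + 1 * c)) / 2
        - (c * deriv f (b + 0 * c) - c * deriv f (b + 1 * c)) / 12)) {0..1}"
  proof (rule corrected_trapezoid_identity)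
    fix t :: real assume t: "t \<in> {0..1}"
    show "((\<lambda>t. f (b + t * c)) has_real_derivative c * deriv f (b + t * c)) (at t)"
      using line[OF assms(5) t, of 1] by simp
    show "((\<lambda>t. c * deriv f (b + t * c)) has_real_derivative c * c * deriv (deriv f) (b + t * c)) (at t)"
      by (rule line[OF assms(6) t])
    show "((\<lambda>t. c * c * deriv (deriv f) (b + t * c)) has_real_derivative c * c * c * f3 (b + t * c)) (at t)"
      unfolding f3_def by (rule line[OF assms(7) t])
  qed
  then have "((\<lambda>t. t * (1 - t) * (2 * t - 1) * (c * c * c * f3 (b + t * c))) has_integral 12 * J) {0..1}"
    by (simp only: J_def mult_zero_left mult_1_left add_0_right)
  \<comment> \<open>The remaining factor \<open>c\<close> accounts for \<open>dx = c dt\<close>, which is valid for either sign of \<open>c\<close>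
      because the integral over \<open>x\<close> is oriented.\<close>
  from has_integral_mult_right[OF this, of "c / 12"]
  have int: "((\<lambda>t. c ^ 4 / 12 * (t * (1 - t) * (2 * t - 1) * f3 (b + t * c))) has_integral c * J) {0..1}"
    by (simp add: power4_eq_xxxx mult_ac)

  have contf: "continuous_on A f"
    using assms(5) by (rule differentiable_imp_continuous_on)
  have contg: "continuous_on {0..1} (\<lambda>t. f (b + t * c))"
    by (rule continuous_on_compose2[OF contf]) (auto intro!: continuous_intros seg)
  have "(LBINT t=ereal 0..ereal 1. c *\<^sub>R f (b + t * c)) = (LBINT x=ereal (b + 0 * c)..ereal (b + 1 * c). f x)"
    by (rule interval_integral_substitution_finite)
       (auto intro!: derivative_eq_intros continuous_on_subset[OF contf] seg)
  moreover have "(LBINT t=ereal 0..ereal 1. c *\<^sub>R f (b + t * c)) = integral {0..1} (\<lambda>t. c *\<^sub>R f (b + t * c))"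
    by (intro interval_integral_eq_integral borel_integrable_atLeastAtMost' continuous_intros contg) auto
  ultimately have lhs: "(LBINT x=ereal b..ereal (b + \<eta> a b). f x)
          - \<eta> a b * ((f b + f (b + \<eta> a b)) / 2)
          - (\<eta> a b)^2 / 12 * (deriv f b - deriv f (b + \<eta> a b)) = c * J"
    by (simp add: J_def c_def power2_eq_square algebra_simps)

  \<comment> \<open>In the second Hoelder factor \<open>W t powr (1 / q)\<close> stands in for \<open>|f'''(b + t c)|\<close>, which makes its
      \<open>q\<close>-th power explicitly integrable.\<close>
  have U: "((\<lambda>t. (t * (1 - t)) powr p) has_integral Beta (1 + p) (1 + p)) {0..1}"
  proof (rule has_integral_eq)
    show "((\<lambda>t. t powr (1 + p - 1) * (1 - t) powr (1 + p - 1)) has_integral Beta (1 + p) (1 + p)) {0..1}"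
      using p by (intro has_integral_Beta_real) auto
  qed (auto simp: powr_mult)
  have V: "((\<lambda>t. (c ^ 4 / 12 * (\<bar>2 * t - 1\<bar> * W t powr (1 / q))) powr q) has_integral
             (c ^ 4 / 12) powr q * ((M + N) / (2 * (q + 1)))) {0..1}"
  proof (rule has_integral_eq)
    show "((\<lambda>t. (c ^ 4 / 12) powr q * (\<bar>2 * t - 1\<bar> powr q * W t)) has_integral
             (c ^ 4 / 12) powr q * ((M + N) / (2 * (q + 1)))) {0..1}"
      unfolding W_def using q by (intro has_integral_mult_right has_integral_abs_powr_affine) auto
    show "(c ^ 4 / 12) powr q * (\<bar>2 * t - 1\<bar> powr q * W t) =
        (c ^ 4 / 12 * (\<bar>2 * t - 1\<bar> * W t powr (1 / q))) powr q" if "t \<in> {0..1}" for t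
    proof -
      have "W t \<ge> 0" using that MN by (simp add: W_def)
      then have "(W t powr (1 / q)) powr q = W t" using q by (simp add: powr_powr)
      moreover have "c ^ 4 / 12 \<ge> 0" by simp
      ultimately show ?thesis by (simp only: powr_mult powr_ge_zero abs_ge_zero mult_nonneg_nonneg)
    qed
  qed
  have "\<bar>c * J\<bar> \<le> Beta (1 + p) (1 + p) powr (1 / p) *
      ((c ^ 4 / 12) powr q * ((M + N) / (2 * (q + 1)))) powr (1 / q)"
  proof (rule integral_bound_Holder[OF p q pq int U V])
    fix t :: real assume t: "t \<in> {0..1}"
    have "\<bar>f3 (b + t * c)\<bar> = (\<bar>f3 (b + t * c)\<bar> powr q) powr (1 / q)"
      using q by (simp add: powr_powr)
    also have "\<dots> \<le> W t powr (1 / q)"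
      using f3_le[OF t] q by (intro powr_mono2) auto
    finally have "c ^ 4 / 12 * (t * (1 - t)) * \<bar>2 * t - 1\<bar> * \<bar>f3 (b + t * c)\<bar> \<le>
      c ^ 4 / 12 * (t * (1 - t)) * \<bar>2 * t - 1\<bar> * W t powr (1 / q)"
      using t by (intro mult_left_mono) auto
    then show "\<bar>c ^ 4 / 12 * (t * (1 - t) * (2 * t - 1) * f3 (b + t * c))\<bar>
       \<le> t * (1 - t) * (c ^ 4 / 12 * (\<bar>2 * t - 1\<bar> * W t powr (1 / q)))"
      using t by (simp add: abs_mult mult_ac)
  qed auto
  also have "\<dots> = c ^ 4 / 96 * sqrt pi powr (1 / p)
          * (Gamma (1 + p) / Gamma (3 / 2 + p)) powr (1 / p)
          * (1 / (q + 1)) powr (1 / q) * (M + N) powr (1 / q)"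
  proof -
    have "Beta (1 + p) (1 + p) powr (1 / p) = sqrt pi powr (1 / p)
        * (Gamma (1 + p) / Gamma (3 / 2 + p)) powr (1 / p) / 2 powr (2 + 1 / p)"
      using p by (simp add: Beta_diagonal powr_divide powr_mult powr_powr field_simps)
    moreover have "((c ^ 4 / 12) powr q * ((M + N) / (2 * (q + 1)))) powr (1 / q) =
        c ^ 4 / 12 * ((M + N) powr (1 / q) * (1 / (q + 1)) powr (1 / q) / 2 powr (1 / q))"
    proof -
      have "((c ^ 4 / 12) powr q) powr (1 / q) = c ^ 4 / 12"
        using q by (simp add: powr_powr)
      moreover have "((M + N) / (2 * (q + 1))) powr (1 / q) =
          (M + N) powr (1 / q) * (1 / (q + 1)) powr (1 / q) / 2 powr (1 / q)"
        using q MN by (simp only: powr_divide powr_mult) simp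
      ultimately show ?thesis
        by (simp only: powr_mult)
    qed
    moreover have "2 powr (2 + 1 / p) * 2 powr (1 / q) = (8 :: real)"
    proof -
      have "2 powr (2 + 1 / p) * 2 powr (1 / q) = (2 :: real) powr (2 + (1 / p + 1 / q))"
        by (simp only: powr_add mult.assoc)
      then show ?thesis by (simp add: pq)
    qed
    moreover have "S * G / D * (C / 12 * (R * Q / E)) = C * S * G * Q * R / (12 * (D * E))"
      for S G D C R Q E :: real by (simp add: mult_ac)
    ultimately show ?thesis by simp
  qed
  finally show ?thesis
    unfolding lhs by (simp add: c_def M_def N_def f3_def)
qed
end
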